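(* Let $G$ be a profinite group, let $\mathcal{B}$ be an open-closed basis of a profinite $G$-space $X$, and let $F$ be a $G$-presheaf of sets over $\mathcal{B}$. Then the sheaf space $p\colon E\to X$ constructed from $F$, considered as a non-equivariant presheaf, has a canonical continuous $G$-action for which $p$ is $G$-equivariant (so that $E$ is a $G$-sheaf of sets over $X$).
   Context: A profinite space is a compact, Hausdorff, totally disconnected space; a profinite group is a topological group whose underlying space is profinite. An open-closed basis is a basis of the topology consisting of sets that are both open and closed. A $G$-sheaf of sets over $X$ is a $G$-equivariant local homeomorphism $p\colon E\to X$ with $E$ a space with continuous left $G$-action. $\mathcal{O}_G(\mathcal{B})$ is the category with objects the elements of $\mathcal{B}$, morphism sets $\mathcal{O}_G(\mathcal{B})(U,V)=\{g\in G\mid gU\subseteq V\}$, and composition given by multiplication. A $G$-presheaf of sets over $\mathcal{B}$ is a functor $F\colon\mathcal{O}_G(\mathcal{B})^{op}\to\mathrm{Sets}$ such that for every $U\in\mathcal{B}$ the action of $\mathrm{stab}_G(U)=\{g\in G\mid gU=U\}$ (subspace topology) on $F(U)$ (discrete topology) is continuous. The sheaf space is $E=\coprod_{x\in X}F_x$, $F_x=\operatorname{colim}_{x\in U\in\mathcal{B}}F(U)$ (colimit along inclusions, i.e. along the morphisms given by $e\in G$), with $p(F_x)=x$ and the topology generated by the sets $\{s_x\mid x\in U\}$ for $U\in\mathcal{B}$, $s\in F(U)$, where $s_x$ is the germ of $s$ at $x$. The canonical action is: for $s\in F(U)$, $x\in U$ and $g\in G$, choose $V\in\mathcal{B}$ with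 $gx\in V\subseteq gU$ and let $g(s_x)$ be the germ at $gx$ of the image of $s$ under $F(g^{-1}\colon V\to U)\colon F(U)\to F(V)$. When $gU\in\mathcal{B}$ one may take $V=gU$, and then $g(s_x)=(g\ast s)_{gx}$ with $g\ast s=F(g^{-1})(s)\in F(gU)$. *)

theory Defs
  imports "HOL-Analysis.Analysis" "HOL-Algebra.Group_Action"
begin

section \<open>Profinite spaces, profinite groups, continuous actions\<close>

definition totally_disconnected_space :: "'x topology \<Rightarrow> bool" where
  "totally_disconnected_space X \<longleftrightarrow>
     (\<forall>C. connectedin X C \<longrightarrow> (\<forall>x\<in>C. \<forall>y\<in>C. x = y))"

definition profinite_space :: "'x topology \<Rightarrow> bool" where
  "profinite_space X \<longleftrightarrow>
     compact_space X \<and> Hausdorff_space X \<and> totally_disconnected_space X"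

definition topological_group :: "('g, 'm) monoid_scheme \<Rightarrow> 'g topology \<Rightarrow> bool" where
  "topological_group G T \<longleftrightarrow>
     group G \<and> topspace T = carrier G \<and>
     continuous_map (prod_topology T T) T (\<lambda>(g, h). g \<otimes>\<^bsub>G\<^esub> h) \<and>
     continuous_map T T (\<lambda>g. inv\<^bsub>G\<^esub> g)"

definition profinite_group :: "('g, 'm) monoid_scheme \<Rightarrow> 'g topology \<Rightarrow> bool" where
  "profinite_group G T \<longleftrightarrow> topological_group G T \<and> profinite_space T"

definition G_space ::
  "('g, 'm) monoid_scheme \<Rightarrow> 'g topology \<Rightarrow> 'x topology \<Rightarrow> ('g \<Rightarrow> 'x \<Rightarrow> 'x) \<Rightarrow> bool" where
  "G_space G T X \<phi> \<longleftrightarrow>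
     group_action G (topspace X) \<phi> \<and>
     continuous_map (prod_topology T X) X (\<lambda>(g, x). \<phi> g x)"

definition open_closed_basis :: "'x topology \<Rightarrow> 'x set set \<Rightarrow> bool" where
  "open_closed_basis X \<B> \<longleftrightarrow>
     openin X = arbitrary union_of (\<lambda>U. U \<in> \<B>) \<and>
     (\<forall>U\<in>\<B>. openin X U \<and> closedin X U)"

section \<open>Equivariant sheaves\<close>

definition local_homeomorphism :: "'e topology \<Rightarrow> 'x topology \<Rightarrow> ('e \<Rightarrow> 'x) \<Rightarrow> bool" where
  "local_homeomorphism E X p \<longleftrightarrow>
     (\<forall>e\<in>topspace E. \<exists>W. openin E W \<and> e \<in> W \<and> openin X (p ` W) \<and>
        homeomorphic_map (subtopology E W) (subtopology X (p ` W)) p)"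

definition G_sheaf ::
  "('g, 'm) monoid_scheme \<Rightarrow> 'g topology \<Rightarrow> 'x topology \<Rightarrow> ('g \<Rightarrow> 'x \<Rightarrow> 'x) \<Rightarrow>
   'e topology \<Rightarrow> ('g \<Rightarrow> 'e \<Rightarrow> 'e) \<Rightarrow> ('e \<Rightarrow> 'x) \<Rightarrow> bool" where
  "G_sheaf G T X \<phi> E \<psi> p \<longleftrightarrow>
     G_space G T E \<psi> \<and> local_homeomorphism E X p \<and>
     (\<forall>g\<in>carrier G. \<forall>e\<in>topspace E. p (\<psi> g e) = \<phi> g (p e))"

section \<open>Equivariant presheaves over a basis\<close>

text \<open>
  A morphism of the category \<open>\<O>\<^sub>G(\<B>)\<close> is a group element together with its source and target.
  Accordingly a functor on the opposite category is given by carrier sets \<open>F U\<close> (taken inside one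
  common type) and maps \<open>r g U V\<close> from \<open>F V\<close> to \<open>F U\<close>, one for each morphism \<open>g\<close> from \<open>U\<close> to \<open>V\<close>.
\<close>

definition OG_hom ::
  "('g, 'm) monoid_scheme \<Rightarrow> ('g \<Rightarrow> 'x \<Rightarrow> 'x) \<Rightarrow> 'x set \<Rightarrow> 'x set \<Rightarrow> 'g set" where
  "OG_hom G \<phi> U V = {g \<in> carrier G. \<phi> g ` U \<subseteq> V}"

definition OG_functor ::
  "('g, 'm) monoid_scheme \<Rightarrow> ('g \<Rightarrow> 'x \<Rightarrow> 'x) \<Rightarrow> 'x set set \<Rightarrow>
   ('x set \<Rightarrow> 's set) \<Rightarrow> ('g \<Rightarrow> 'x set \<Rightarrow> 'x set \<Rightarrow> 's \<Rightarrow> 's) \<Rightarrow> bool" where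
  "OG_functor G \<phi> \<B> F r \<longleftrightarrow>
     (\<forall>U\<in>\<B>. \<forall>V\<in>\<B>. \<forall>g\<in>OG_hom G \<phi> U V. r g U V \<in> F V \<rightarrow> F U) \<and>
     (\<forall>U\<in>\<B>. \<forall>s\<in>F U. r \<one>\<^bsub>G\<^esub> U U s = s) \<and>
     (\<forall>U\<in>\<B>. \<forall>V\<in>\<B>. \<forall>W\<in>\<B>. \<forall>g\<in>OG_hom G \<phi> U V. \<forall>h\<in>OG_hom G \<phi> V W. \<forall>s\<in>F W.
        r (h \<otimes>\<^bsub>G\<^esub> g) U W s = r g U V (r h V W s))"

definition set_stab ::
  "('g, 'm) monoid_scheme \<Rightarrow> ('g \<Rightarrow> 'x \<Rightarrow> 'x) \<Rightarrow> 'x set \<Rightarrow> 'g set" where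
  "set_stab G \<phi> U = {g \<in> carrier G. \<phi> g ` U = U}"

text \<open>
  Since \<open>F\<close> is contravariant, the left action of the stabilizer of \<open>U\<close> on \<open>F U\<close> is through inverses.
\<close>

definition G_presheaf ::
  "('g, 'm) monoid_scheme \<Rightarrow> 'g topology \<Rightarrow> ('g \<Rightarrow> 'x \<Rightarrow> 'x) \<Rightarrow> 'x set set \<Rightarrow>
   ('x set \<Rightarrow> 's set) \<Rightarrow> ('g \<Rightarrow> 'x set \<Rightarrow> 'x set \<Rightarrow> 's \<Rightarrow> 's) \<Rightarrow> bool" where
  "G_presheaf G T \<phi> \<B> F r \<longleftrightarrow>
     OG_functor G \<phi> \<B> F r \<and>
     (\<forall>U\<in>\<B>. continuous_map
        (prod_topology (subtopology T (set_stab G \<phi> U)) (discrete_topology (F U)))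
        (discrete_topology (F U))
        (\<lambda>(g, s). r (inv\<^bsub>G\<^esub> g) U U s))"

section \<open>The sheaf space\<close>

text \<open>
  The stalk at \<open>x\<close> is the usual model of the filtered colimit of the sets \<open>F U\<close>, over the members
  \<open>U\<close> of \<open>\<B>\<close> containing \<open>x\<close>: pairs \<open>(U, s)\<close> modulo agreement after restriction to a smaller
  neighbourhood. Restriction is along the morphisms given by the unit of \<open>G\<close>.
\<close>

definition local_sections :: "'x set set \<Rightarrow> ('x set \<Rightarrow> 's set) \<Rightarrow> 'x \<Rightarrow> ('x set \<times> 's) set" where
  "local_sections \<B> F x = {(U, s). U \<in> \<B> \<and> x \<in> U \<and> s \<in> F U}"

definition germ_rel ::
  "('g, 'm) monoid_scheme \<Rightarrow> 'x set set \<Rightarrow> ('x set \<Rightarrow> 's set) \<Rightarrow>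
   ('g \<Rightarrow> 'x set \<Rightarrow> 'x set \<Rightarrow> 's \<Rightarrow> 's) \<Rightarrow> 'x \<Rightarrow> (('x set \<times> 's) \<times> ('x set \<times> 's)) set" where
  "germ_rel G \<B> F r x =
     {((U, s), (V, t)). (U, s) \<in> local_sections \<B> F x \<and> (V, t) \<in> local_sections \<B> F x \<and>
        (\<exists>W\<in>\<B>. x \<in> W \<and> W \<subseteq> U \<inter> V \<and> r \<one>\<^bsub>G\<^esub> W U s = r \<one>\<^bsub>G\<^esub> W V t)}"

definition stalk ::
  "('g, 'm) monoid_scheme \<Rightarrow> 'x set set \<Rightarrow> ('x set \<Rightarrow> 's set) \<Rightarrow>
   ('g \<Rightarrow> 'x set \<Rightarrow> 'x set \<Rightarrow> 's \<Rightarrow> 's) \<Rightarrow> 'x \<Rightarrow> ('x set \<times> 's) set set" where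
  "stalk G \<B> F r x = local_sections \<B> F x // germ_rel G \<B> F r x"

text \<open>
  Points of the disjoint union of the stalks are tagged by their base point, so that the projection
  to \<open>X\<close> is \<^const>\<open>fst\<close>.
\<close>

definition germ ::
  "('g, 'm) monoid_scheme \<Rightarrow> 'x set set \<Rightarrow> ('x set \<Rightarrow> 's set) \<Rightarrow>
   ('g \<Rightarrow> 'x set \<Rightarrow> 'x set \<Rightarrow> 's \<Rightarrow> 's) \<Rightarrow> 'x set \<Rightarrow> 's \<Rightarrow> 'x \<Rightarrow> 'x \<times> ('x set \<times> 's) set" where
  "germ G \<B> F r U s x = (x, germ_rel G \<B> F r x `` {(U, s)})"

definition sheaf_space ::
  "('g, 'm) monoid_scheme \<Rightarrow> 'x topology \<Rightarrow> 'x set set \<Rightarrow> ('x set \<Rightarrow> 's set) \<Rightarrow>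
   ('g \<Rightarrow> 'x set \<Rightarrow> 'x set \<Rightarrow> 's \<Rightarrow> 's) \<Rightarrow> ('x \<times> ('x set \<times> 's) set) set" where
  "sheaf_space G X \<B> F r = Sigma (topspace X) (stalk G \<B> F r)"

definition sheaf_topology ::
  "('g, 'm) monoid_scheme \<Rightarrow> 'x set set \<Rightarrow> ('x set \<Rightarrow> 's set) \<Rightarrow>
   ('g \<Rightarrow> 'x set \<Rightarrow> 'x set \<Rightarrow> 's \<Rightarrow> 's) \<Rightarrow> ('x \<times> ('x set \<times> 's) set) topology" where
  "sheaf_topology G \<B> F r =
     topology_generated_by {germ G \<B> F r U s ` U | U s. U \<in> \<B> \<and> s \<in> F U}"

lemma topspace_sheaf_topology:
  assumes "open_closed_basis X \<B>"
  shows "topspace (sheaf_topology G \<B> F r) = sheaf_space G X \<B> F r"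
proof -
  have "openin X U" if "U \<in> \<B>" for U
    using assms that unfolding open_closed_basis_def by blast
  then have sub: "x \<in> topspace X" if "U \<in> \<B>" "x \<in> U" for U x
    using openin_subset that by blast
  have "e \<in> sheaf_space G X \<B> F r \<longleftrightarrow>
      (\<exists>U\<in>\<B>. \<exists>s\<in>F U. \<exists>x\<in>U. e = germ G \<B> F r U s x)" for e
  proof
    assume "\<exists>U\<in>\<B>. \<exists>s\<in>F U. \<exists>x\<in>U. e = germ G \<B> F r U s x"
    then obtain U s x where *: "U \<in> \<B>" "s \<in> F U" "x \<in> U" "e = germ G \<B> F r U s x"
      by blast
    then have "(U, s) \<in> local_sections \<B> F x"
      by (simp add: local_sections_def)
    then have "germ_rel G \<B> F r x `` {(U, s)} \<in> stalk G \<B> F r x"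
      unfolding stalk_def by (rule quotientI)
    with * sub[of U x] show "e \<in> sheaf_space G X \<B> F r"
      by (simp add: sheaf_space_def germ_def)
  next
    assume "e \<in> sheaf_space G X \<B> F r"
    then obtain x c where e: "e = (x, c)" "c \<in> stalk G \<B> F r x"
      unfolding sheaf_space_def by blast
    from e(2) obtain q where q: "q \<in> local_sections \<B> F x" "c = germ_rel G \<B> F r x `` {q}"
      unfolding stalk_def by (rule quotientE)
    obtain U s where "q = (U, s)"
      by (cases q)
    with e(1) q have "U \<in> \<B>" "s \<in> F U" "x \<in> U" "e = germ G \<B> F r U s x"
      by (simp_all add: local_sections_def germ_def)
    then show "\<exists>U\<in>\<B>. \<exists>s\<in>F U. \<exists>x\<in>U. e = germ G \<B> F r U s x"
      by blast
  qed
  moreover have "topspace (sheaf_topology G \<B> F r) = (\<Union>U\<in>\<B>. \<Union>s\<in>F U. germ G \<B> F r U s ` U)"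
    unfolding sheaf_topology_def topology_generated_by_topspace
    by auto
  ultimately show ?thesis
    by (intro Set.set_eqI) (simp only: UN_iff image_iff)
qed

text \<open>
  The canonical action chooses a section \<open>s\<close> over some \<open>U\<close> representing a given germ at \<open>x\<close> and a
  member \<open>V\<close> of \<open>\<B>\<close> with \<open>g x \<in> V \<subseteq> g U\<close>. That these choices do not matter is not built into the
  definition.
\<close>

definition canonical_action ::
  "('g, 'm) monoid_scheme \<Rightarrow> 'x topology \<Rightarrow> ('g \<Rightarrow> 'x \<Rightarrow> 'x) \<Rightarrow> 'x set set \<Rightarrow>
   ('x set \<Rightarrow> 's set) \<Rightarrow> ('g \<Rightarrow> 'x set \<Rightarrow> 'x set \<Rightarrow> 's \<Rightarrow> 's) \<Rightarrow>
   'g \<Rightarrow> 'x \<times> ('x set \<times> 's) set \<Rightarrow> 'x \<times> ('x set \<times> 's) set" where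
  "canonical_action G X \<phi> \<B> F r = (\<lambda>g. \<lambda>e\<in>sheaf_space G X \<B> F r.
     SOME e'. \<exists>U\<in>\<B>. \<exists>s\<in>F U. \<exists>x\<in>U. \<exists>V\<in>\<B>.
       e = germ G \<B> F r U s x \<and> \<phi> g x \<in> V \<and> V \<subseteq> \<phi> g ` U \<and>
       e' = germ G \<B> F r V (r (inv\<^bsub>G\<^esub> g) V U s) (\<phi> g x))"

end

theory Submission
  imports Defs
begin

text \<open>
  The germ of \<open>s\<close> over \<open>U\<close> at \<open>x\<close> is moved to the germ at \<open>\<phi> g x\<close> of the pullback of \<open>s\<close> along
  \<open>inv g\<close>; functoriality makes this independent of the choices and multiplicative in \<open>g\<close>. For joint
  continuity near \<open>g\<close>, write the image germ as that of a section \<open>t\<close> over a basic set \<open>V\<close>. As \<open>V\<close> is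
  compact and open, the stabilizer of \<open>V\<close> is open in \<open>G\<close>, hence so is the subgroup \<open>K\<close> of it that
  fixes \<open>t\<close>; and every element of \<open>K g\<close> moves the germs of \<open>s\<close> over the preimage of \<open>V\<close> under \<open>g\<close>
  to germs of the same section \<open>t\<close>.
\<close>

section \<open>Open stabilizers of open-closed sets\<close>

lemma openin_set_stab:
  assumes T: "topological_group G T" and act: "G_space G T X \<phi>" and "compact_space X"
    and V: "openin X V" "closedin X V"
  shows "openin T (set_stab G \<phi> V)"
proof -
  interpret group_action G "topspace X" \<phi>
    using act by (simp add: G_space_def)
  have top: "topspace T = carrier G" and inv_cont: "continuous_map T T (\<lambda>g. inv\<^bsub>G\<^esub> g)" and "group G"
    using T by (simp_all add: topological_group_def)
  interpret G: group G by fact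
  have VX: "V \<subseteq> topspace X"
    using V(1) openin_subset by blast
  define N where "N = {g \<in> carrier G. \<phi> g ` V \<subseteq> V}"
  \<comment> \<open>\<open>Z\<close> collects the pairs \<open>(g, x)\<close> that witness the
    failure of the inclusion. It is closed because \<open>V\<close> is both open (first factor of
    the intersection) and closed (second factor).\<close>
  define Z where "Z = {z \<in> topspace (prod_topology T X). (case z of (g, x) \<Rightarrow> \<phi> g x) \<in> topspace X - V}
                      \<inter> (topspace T \<times> V)"
  have "closedin (prod_topology T X) Z"
    unfolding Z_def
    by (intro closedin_Int closedin_continuous_map_preimage[where Y = X])
       (use act V in \<open>auto simp: G_space_def closedin_prod_Times_iff\<close>)
  then have "closedin T (fst ` Z)"
    using closed_map_fst[OF \<open>compact_space X\<close>, of T] by (simp add: closed_map_def)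
  moreover have "N = topspace T - fst ` Z"
  proof -
    have "\<phi> g x \<in> topspace X" if "g \<in> carrier G" "x \<in> V" for g x
      using element_image that VX by blast
    then have "Z = {(g, x). g \<in> carrier G \<and> x \<in> V \<and> \<phi> g x \<notin> V}"
      using VX by (auto simp: Z_def top)
    then show ?thesis
      by (auto simp: N_def top image_iff) blast
  qed
  ultimately have N: "openin T N"
    by auto
  have "set_stab G \<phi> V = N \<inter> {g \<in> topspace T. inv\<^bsub>G\<^esub> g \<in> N}"
  proof (intro Set.set_eqI iffI)
    fix g assume g: "g \<in> set_stab G \<phi> V"
    have "\<phi> (inv\<^bsub>G\<^esub> g) x \<in> V" if "x \<in> V" for x
    proof -
      have "x \<in> \<phi> g ` V"
        using g that by (simp add: set_stab_def)
      then obtain y where "y \<in> V" "\<phi> g y = x"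
        by blast
      then show ?thesis
        using orbit_sym_aux[of g y x] g VX unfolding set_stab_def by auto
    qed
    with g show "g \<in> N \<inter> {g \<in> topspace T. inv\<^bsub>G\<^esub> g \<in> N}"
      by (auto simp: set_stab_def N_def top)
  next
    fix g assume "g \<in> N \<inter> {g \<in> topspace T. inv\<^bsub>G\<^esub> g \<in> N}"
    then have g: "g \<in> carrier G" "\<phi> g ` V \<subseteq> V" "\<phi> (inv\<^bsub>G\<^esub> g) ` V \<subseteq> V"
      by (auto simp: N_def)
    have "x \<in> \<phi> g ` V" if "x \<in> V" for x
      using orbit_sym_aux[of "inv\<^bsub>G\<^esub> g" x] g VX that
      by (metis G.inv_closed G.inv_inv image_eqI image_subset_iff subsetD)
    with g show "g \<in> set_stab G \<phi> V"
      by (auto simp: set_stab_def)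
  qed
  then show ?thesis
    using N openin_continuous_map_preimage[OF inv_cont N] by auto
qed

section \<open>The presheaf data and the action on the base space\<close>

locale equivariant_presheaf =
  fixes G :: "('g, 'm) monoid_scheme" (structure) and T :: "'g topology"
    and X :: "'x topology" and \<phi> :: "'g \<Rightarrow> 'x \<Rightarrow> 'x" and \<B> :: "'x set set"
    and F :: "'x set \<Rightarrow> 's set" and r :: "'g \<Rightarrow> 'x set \<Rightarrow> 'x set \<Rightarrow> 's \<Rightarrow> 's"
  assumes topological_group: "topological_group G T"
    and compact: "compact_space X"
    and G_space: "G_space G T X \<phi>"
    and basis: "open_closed_basis X \<B>"
    and presheaf: "G_presheaf G T \<phi> \<B> F r"
begin

sublocale group_action G "topspace X" \<phi>
  using G_space by (simp add: G_space_def)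

sublocale G: group G
  using topological_group by (simp add: topological_group_def)

abbreviation E where "E \<equiv> sheaf_topology G \<B> F r"
abbreviation gm where "gm \<equiv> germ G \<B> F r"
abbreviation \<psi> where "\<psi> \<equiv> canonical_action G X \<phi> \<B> F r"

lemma topspace_T: "topspace T = carrier G"
  using topological_group by (simp add: topological_group_def)

lemma basis_open: "U \<in> \<B> \<Longrightarrow> openin X U"
  and basis_closed: "U \<in> \<B> \<Longrightarrow> closedin X U"
  using basis by (auto simp: open_closed_basis_def)

lemma basis_subset: "U \<in> \<B> \<Longrightarrow> x \<in> U \<Longrightarrow> x \<in> topspace X"
  using basis_open openin_subset by blast

lemma basis_refine: "openin X O' \<Longrightarrow> x \<in> O' \<Longrightarrow> \<exists>V\<in>\<B>. x \<in> V \<and> V \<subseteq> O'"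
  using basis unfolding open_closed_basis_def openin_topology_base_unique by blast

lemma act_inverse:
  assumes "g \<in> carrier G" "x \<in> topspace X"
  shows "\<phi> (inv g) (\<phi> g x) = x" "\<phi> g (\<phi> (inv g) x) = x"
proof -
  show "\<phi> (inv g) (\<phi> g x) = x"
    using orbit_sym_aux[of g x] assms by simp
  show "\<phi> g (\<phi> (inv g) x) = x"
    using orbit_sym_aux[of "inv g" x] assms by simp
qed

lemma act_closed: "g \<in> carrier G \<Longrightarrow> x \<in> topspace X \<Longrightarrow> \<phi> g x \<in> topspace X"
  using element_image by blast

lemma act_continuous: "g \<in> carrier G \<Longrightarrow> continuous_map X X (\<phi> g)"
proof -
  assume g: "g \<in> carrier G"
  have "continuous_map X (prod_topology T X) (\<lambda>x. (g, x))"
    using g by (auto simp: continuous_map_pairwise o_def topspace_T)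
  moreover have "continuous_map (prod_topology T X) X (\<lambda>(g, x). \<phi> g x)"
    using G_space by (simp add: G_space_def)
  ultimately show ?thesis
    using continuous_map_compose by (fastforce simp: o_def)
qed

text \<open>Written as a preimage under the inverse element, the image is open by continuity alone,
  which gives \<open>act_open\<close>.\<close>

lemma act_image:
  assumes "g \<in> carrier G" "U \<subseteq> topspace X"
  shows "\<phi> g ` U = {y \<in> topspace X. \<phi> (inv g) y \<in> U}"
  using assms act_inverse[OF assms(1)] act_closed[OF assms(1)] by (force simp: image_iff)

lemma act_open: "g \<in> carrier G \<Longrightarrow> openin X U \<Longrightarrow> openin X (\<phi> g ` U)"
  using openin_continuous_map_preimage[OF act_continuous, of "inv g" U]
  by (simp add: act_image openin_subset)

section \<open>Calculus of the restriction maps\<close>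

lemma restrict_closed:
  "U \<in> \<B> \<Longrightarrow> V \<in> \<B> \<Longrightarrow> g \<in> carrier G \<Longrightarrow> \<phi> g ` U \<subseteq> V \<Longrightarrow> s \<in> F V \<Longrightarrow> r g U V s \<in> F U"
  using presheaf by (auto simp: G_presheaf_def OG_functor_def OG_hom_def Pi_iff)

lemma restrict_id: "U \<in> \<B> \<Longrightarrow> s \<in> F U \<Longrightarrow> r \<one> U U s = s"
  using presheaf by (auto simp: G_presheaf_def OG_functor_def)

lemma restrict_comp:
  "U \<in> \<B> \<Longrightarrow> V \<in> \<B> \<Longrightarrow> W \<in> \<B> \<Longrightarrow> g \<in> carrier G \<Longrightarrow> h \<in> carrier G \<Longrightarrow> \<phi> g ` U \<subseteq> V
    \<Longrightarrow> \<phi> h ` V \<subseteq> W \<Longrightarrow> s \<in> F W \<Longrightarrow> r g U V (r h V W s) = r (h \<otimes> g) U W s"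
  using presheaf by (auto simp: G_presheaf_def OG_functor_def OG_hom_def)

lemma one_image: "U \<subseteq> topspace X \<Longrightarrow> \<phi> \<one> ` U = U"
  using id_eq_one[symmetric] by (force simp: image_iff subset_iff)

lemma one_image_basis: "U \<in> \<B> \<Longrightarrow> \<phi> \<one> ` U = U"
  using one_image basis_subset by blast

lemma inv_image_subset:
  assumes "g \<in> carrier G" "U \<in> \<B>" "V \<subseteq> \<phi> g ` U"
  shows "\<phi> (inv g) ` V \<subseteq> U"
  using assms act_inverse[OF assms(1)] basis_subset[OF assms(2)] by force

text \<open>Functoriality when the other morphism is an inclusion: this and
  \<open>restrict_one_right\<close> absorb an ordinary restriction performed after, respectively
  before, a pullback along a group element.\<close>

lemma restrict_one_left:
  assumes "U \<in> \<B>" "V \<in> \<B>" "W \<in> \<B>" "h \<in> carrier G" "U \<subseteq> V" "\<phi> h ` V \<subseteq> W" "s \<in> F W"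
  shows "r \<one> U V (r h V W s) = r h U W s"
  using restrict_comp[of U V W \<one> h s] assms one_image_basis[of U] by simp

lemma restrict_one_right:
  assumes "U \<in> \<B>" "V \<in> \<B>" "W \<in> \<B>" "g \<in> carrier G" "\<phi> g ` U \<subseteq> V" "V \<subseteq> W" "s \<in> F W"
  shows "r g U V (r \<one> V W s) = r g U W s"
  using restrict_comp[of U V W g \<one> s] assms one_image_basis[of V] by simp

section \<open>Germs and equality of germs\<close>

text \<open>Only transitivity needs an argument: the two witnessing neighbourhoods meet in an open
  set, which contains a member of \<open>\<B>\<close> around \<open>x\<close>, and both agreements
  restrict to it.\<close>

lemma equiv_germ_rel: "equiv (local_sections \<B> F x) (germ_rel G \<B> F r x)"
proof (rule equivI)
  show "refl_on (local_sections \<B> F x) (germ_rel G \<B> F r x)"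
    by (auto simp: refl_on_def germ_rel_def local_sections_def)
  show "sym (germ_rel G \<B> F r x)"
    by (force simp: sym_def germ_rel_def)
  show "germ_rel G \<B> F r x \<subseteq> local_sections \<B> F x \<times> local_sections \<B> F x"
    by (auto simp: germ_rel_def)
  show "trans (germ_rel G \<B> F r x)"
  proof (rule transI)
    fix a b c assume ab: "(a, b) \<in> germ_rel G \<B> F r x" and bc: "(b, c) \<in> germ_rel G \<B> F r x"
    obtain A s B t C u where abc: "a = (A, s)" "b = (B, t)" "c = (C, u)"
      by (metis surj_pair)
    obtain W where W: "W \<in> \<B>" "x \<in> W" "W \<subseteq> A" "W \<subseteq> B" "r \<one> W A s = r \<one> W B t"
      and a: "A \<in> \<B>" "s \<in> F A" "x \<in> A" and b: "B \<in> \<B>" "t \<in> F B" "x \<in> B"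
      using ab abc by (auto simp: germ_rel_def local_sections_def)
    obtain W' where W': "W' \<in> \<B>" "x \<in> W'" "W' \<subseteq> B" "W' \<subseteq> C" "r \<one> W' B t = r \<one> W' C u"
      and c: "C \<in> \<B>" "u \<in> F C" "x \<in> C"
      using bc abc by (auto simp: germ_rel_def local_sections_def)
    obtain Y where Y: "Y \<in> \<B>" "x \<in> Y" "Y \<subseteq> W \<inter> W'"
      using basis_refine[of "W \<inter> W'" x] basis_open W W' by blast
    have "r \<one> Y A s = r \<one> Y W (r \<one> W A s)"
      using restrict_one_left[of Y W A \<one> s] W Y a one_image_basis by auto
    also have "\<dots> = r \<one> Y B t"
      using restrict_one_left[of Y W B \<one> t] W Y b one_image_basis by auto
    also have "\<dots> = r \<one> Y W' (r \<one> W' B t)"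
      using restrict_one_left[of Y W' B \<one> t] W' Y b one_image_basis by auto
    also have "\<dots> = r \<one> Y C u"
      using restrict_one_left[of Y W' C \<one> u] W' Y c one_image_basis by auto
    finally have "r \<one> Y A s = r \<one> Y C u" .
    moreover have "Y \<subseteq> A \<inter> C"
      using W W' Y by blast
    ultimately show "(a, c) \<in> germ_rel G \<B> F r x"
      using a c Y(1,2) unfolding abc germ_rel_def local_sections_def by blast
  qed
qed

lemma germ_eq_iff:
  assumes "U \<in> \<B>" "s \<in> F U" "x \<in> U" "V \<in> \<B>" "t \<in> F V" "y \<in> V"
  shows "gm U s x = gm V t y \<longleftrightarrow>
    x = y \<and> (\<exists>W\<in>\<B>. x \<in> W \<and> W \<subseteq> U \<inter> V \<and> r \<one> W U s = r \<one> W V t)"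
proof (cases "x = y")
  case True
  have *: "(U, s) \<in> local_sections \<B> F x" "(V, t) \<in> local_sections \<B> F x"
    using assms True by (auto simp: local_sections_def)
  have "gm U s x = gm V t y \<longleftrightarrow> ((U, s), (V, t)) \<in> germ_rel G \<B> F r x"
    using eq_equiv_class_iff[OF equiv_germ_rel *] True by (simp add: germ_def)
  with True * show ?thesis
    by (simp add: germ_rel_def)
qed (simp add: germ_def)

text \<open>\<open>V\<close> itself witnesses the equality, since restricting once more from
  \<open>V\<close> to \<open>V\<close> is the identity.\<close>

lemma germ_restrict:
  assumes "U \<in> \<B>" "V \<in> \<B>" "x \<in> V" "V \<subseteq> U" "s \<in> F U"
  shows "gm V (r \<one> V U s) x = gm U s x"
proof -
  have "\<phi> \<one> ` V \<subseteq> U"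
    using assms one_image_basis by auto
  then have t: "r \<one> V U s \<in> F V"
    using restrict_closed assms by simp
  show ?thesis
    using assms t by (subst germ_eq_iff) (auto simp: restrict_id intro!: bexI[of _ V])
qed

lemma topspace_E: "topspace E = sheaf_space G X \<B> F r"
  using topspace_sheaf_topology[OF basis] .

lemma topspace_E_germs: "e \<in> topspace E \<longleftrightarrow> (\<exists>U\<in>\<B>. \<exists>s\<in>F U. \<exists>x\<in>U. e = gm U s x)"
  by (auto simp: sheaf_topology_def)

lemma germ_in_E: "U \<in> \<B> \<Longrightarrow> s \<in> F U \<Longrightarrow> x \<in> U \<Longrightarrow> gm U s x \<in> topspace E"
  using topspace_E_germs by blast

lemma fst_germ [simp]: "fst (gm U s x) = x"
  by (simp add: germ_def)

section \<open>The canonical action on germs is well defined\<close>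

lemma basis_act_neighbourhood:
  assumes "g \<in> carrier G" "U \<in> \<B>" "x \<in> U"
  shows "\<exists>V\<in>\<B>. \<phi> g x \<in> V \<and> V \<subseteq> \<phi> g ` U"
  using basis_refine[OF act_open[OF assms(1) basis_open[OF assms(2)]]] assms(3) by blast

lemma pullback_closed:
  assumes "g \<in> carrier G" "U \<in> \<B>" "V \<in> \<B>" "V \<subseteq> \<phi> g ` U" "s \<in> F U"
  shows "r (inv g) V U s \<in> F V"
  using restrict_closed assms inv_image_subset by simp

text \<open>This is the independence of all choices at once: the representative of the germ as well
  as the target neighbourhood.\<close>

lemma pullback_germ_cong:
  assumes g: "g \<in> carrier G"
    and U: "U \<in> \<B>" "s \<in> F U" "x \<in> U" "V \<in> \<B>" "\<phi> g x \<in> V" "V \<subseteq> \<phi> g ` U"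
    and U': "U' \<in> \<B>" "s' \<in> F U'" "x' \<in> U'" "V' \<in> \<B>" "\<phi> g x' \<in> V'" "V' \<subseteq> \<phi> g ` U'"
    and eq: "gm U s x = gm U' s' x'"
  shows "gm V (r (inv g) V U s) (\<phi> g x) = gm V' (r (inv g) V' U' s') (\<phi> g x')"
proof -
  obtain W where W: "W \<in> \<B>" "x \<in> W" "W \<subseteq> U" "W \<subseteq> U'" "r \<one> W U s = r \<one> W U' s'" and x: "x' = x"
    using eq[unfolded germ_eq_iff[OF U(1-3) U'(1-3)]] by blast
  obtain Y where Y: "Y \<in> \<B>" "\<phi> g x \<in> Y" "Y \<subseteq> V \<inter> V' \<inter> \<phi> g ` W"
    using basis_refine[of "V \<inter> V' \<inter> \<phi> g ` W" "\<phi> g x"] U U' W x g act_open basis_open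
    by (metis (no_types, lifting) IntI image_eqI openin_Int)
  have YW: "\<phi> (inv g) ` Y \<subseteq> W"
    using inv_image_subset[OF g W(1)] Y by simp
  \<comment> \<open>Both sides equal \<open>r (inv g) Y U s\<close>. The claim is general in
    \<open>U\<close>, \<open>s\<close>, \<open>V\<close> so that it serves the primed data
    too.\<close>
  have restr: "r \<one> Y V (r (inv g) V U s) = r (inv g) Y W (r \<one> W U s)"
    if "U \<in> \<B>" "s \<in> F U" "V \<in> \<B>" "V \<subseteq> \<phi> g ` U" "W \<subseteq> U" "Y \<subseteq> V" for U s V
    using that Y(1) YW W(1) g inv_image_subset[OF g that(1,4)]
    by (simp add: restrict_one_left restrict_one_right)
  have "r \<one> Y V (r (inv g) V U s) = r \<one> Y V' (r (inv g) V' U' s')"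
    using restr[of U s V] restr[of U' s' V'] U U' W Y by simp
  then show ?thesis
    using U U' Y x g by (subst germ_eq_iff) (auto simp: pullback_closed)
qed

text \<open>By \<open>pullback_germ_cong\<close> all candidates of the choice operator coincide, so
  it must return this one.\<close>

lemma canonical_action_germ:
  assumes g: "g \<in> carrier G" and U: "U \<in> \<B>" "s \<in> F U" "x \<in> U" "V \<in> \<B>" "\<phi> g x \<in> V" "V \<subseteq> \<phi> g ` U"
  shows "\<psi> g (gm U s x) = gm V (r (inv g) V U s) (\<phi> g x)"
proof -
  have mem: "gm U s x \<in> sheaf_space G X \<B> F r"
    using germ_in_E U topspace_E by blast
  show ?thesis
    unfolding canonical_action_def restrict_apply'[OF mem]
  proof (rule some_equality, goal_cases)
    case 1
    then show ?case
      using U by blast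
  next
    case (2 e')
    then obtain U' s' x' V' where "U' \<in> \<B>" "s' \<in> F U'" "x' \<in> U'" "V' \<in> \<B>" "gm U s x = gm U' s' x'"
      "\<phi> g x' \<in> V'" "V' \<subseteq> \<phi> g ` U'" "e' = gm V' (r (inv g) V' U' s') (\<phi> g x')"
      by blast
    then show ?case
      using pullback_germ_cong[OF g U] by simp
  qed
qed

lemma canonical_action_closed:
  assumes g: "g \<in> carrier G" and e: "e \<in> topspace E"
  shows "\<psi> g e \<in> topspace E" and "fst (\<psi> g e) = \<phi> g (fst e)"
proof -
  obtain U s x where U: "U \<in> \<B>" "s \<in> F U" "x \<in> U" "e = gm U s x"
    using e topspace_E_germs by blast
  obtain V where V: "V \<in> \<B>" "\<phi> g x \<in> V" "V \<subseteq> \<phi> g ` U"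
    using basis_act_neighbourhood g U by blast
  have eq: "\<psi> g e = gm V (r (inv g) V U s) (\<phi> g x)"
    using canonical_action_germ g U V by simp
  show "\<psi> g e \<in> topspace E"
    unfolding eq using germ_in_E V U g pullback_closed by blast
  show "fst (\<psi> g e) = \<phi> g (fst e)"
    unfolding eq using U by simp
qed

section \<open>The group action laws\<close>

lemma canonical_action_one:
  assumes e: "e \<in> topspace E"
  shows "\<psi> \<one> e = e"
proof -
  obtain U s x where U: "U \<in> \<B>" "s \<in> F U" "x \<in> U" "e = gm U s x"
    using e topspace_E_germs by blast
  have "\<phi> \<one> x = x"
    using id_eq_one[symmetric] U basis_subset by simp
  then show ?thesis
    using canonical_action_germ[of \<one> U s x U] U one_image_basis by (simp add: restrict_id)
qed

text \<open>Contravariance and inversion cancel: pulling back along \<open>inv h\<close> and then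
  along \<open>inv g\<close> is pulling back along \<open>inv h \<otimes> inv g\<close>, the inverse
  of \<open>g \<otimes> h\<close>.\<close>

lemma canonical_action_mult:
  assumes g: "g \<in> carrier G" and h: "h \<in> carrier G" and e: "e \<in> topspace E"
  shows "\<psi> (g \<otimes> h) e = \<psi> g (\<psi> h e)"
proof -
  obtain U s x where U: "U \<in> \<B>" "s \<in> F U" "x \<in> U" "e = gm U s x"
    using e topspace_E_germs by blast
  have xX: "x \<in> topspace X"
    using U basis_subset by blast
  obtain V where V: "V \<in> \<B>" "\<phi> h x \<in> V" "V \<subseteq> \<phi> h ` U"
    using basis_act_neighbourhood h U by blast
  obtain W where W: "W \<in> \<B>" "\<phi> g (\<phi> h x) \<in> W" "W \<subseteq> \<phi> g ` V"
    using basis_act_neighbourhood g V by blast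
  have comp: "\<phi> (g \<otimes> h) y = \<phi> g (\<phi> h y)" if "y \<in> topspace X" for y
    using composition_rule that g h by simp
  have "W \<subseteq> \<phi> g ` \<phi> h ` U"
    using W V by blast
  also have "\<dots> = \<phi> (g \<otimes> h) ` U"
    using comp basis_subset[OF U(1)] by (force simp: image_iff)
  \<comment> \<open>Hence \<open>W\<close>, chosen for the second move, is also an admissible
    neighbourhood for moving \<open>e\<close> by \<open>g \<otimes> h\<close> in one go.\<close>
  finally have WU: "W \<subseteq> \<phi> (g \<otimes> h) ` U" .
  have "\<psi> g (\<psi> h e) = gm W (r (inv g) W V (r (inv h) V U s)) (\<phi> g (\<phi> h x))"
    using canonical_action_germ[OF h U(1-3) V] canonical_action_germ[OF g V(1) _ V(2) W] U V h
    by (simp add: pullback_closed)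
  also have "r (inv g) W V (r (inv h) V U s) = r (inv h \<otimes> inv g) W U s"
    using restrict_comp[of W V U "inv g" "inv h" s] W V U g h inv_image_subset by simp
  also have "inv h \<otimes> inv g = inv (g \<otimes> h)"
    using g h by (simp add: G.inv_mult_group)
  also have "gm W (r (inv (g \<otimes> h)) W U s) (\<phi> g (\<phi> h x)) = \<psi> (g \<otimes> h) e"
    using canonical_action_germ[of "g \<otimes> h" U s x W] U W WU g h comp[OF xX] by simp
  finally show ?thesis by simp
qed

lemma group_action_canonical: "group_action G (topspace E) \<psi>"
proof -
  have Bij: "\<psi> g \<in> Bij (topspace E)" if g: "g \<in> carrier G" for g
  proof -
    \<comment> \<open>\<open>Bij\<close> demands extensional maps; this is why the definition of the
      action is restricted to the sheaf space.\<close>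
    have "\<psi> g \<in> extensional (topspace E)"
      by (simp add: canonical_action_def topspace_E)
    moreover have "bij_betw (\<psi> g) (topspace E) (topspace E)"
      by (rule bij_betw_byWitness[where f' = "\<psi> (inv g)"])
         (use g canonical_action_closed in
           \<open>auto simp flip: canonical_action_mult simp: canonical_action_one\<close>)
    ultimately show ?thesis
      by (simp add: Bij_def)
  qed
  have "\<psi> \<in> hom G (BijGroup (topspace E))"
  proof (rule homI)
    fix g h assume gh: "g \<in> carrier G" "h \<in> carrier G"
    have "\<psi> (g \<otimes> h) = compose (topspace E) (\<psi> g) (\<psi> h)"
      by (rule extensionalityI[where A = "topspace E"])
         (use gh Bij in \<open>auto simp: Bij_def compose_def canonical_action_mult\<close>)
    then show "\<psi> (g \<otimes> h) = \<psi> g \<otimes>\<^bsub>BijGroup (topspace E)\<^esub> \<psi> h"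
      using Bij gh by (simp add: BijGroup_def)
  qed (simp add: BijGroup_def Bij)
  then show ?thesis
    unfolding group_action_def
    by (simp add: group_hom_def group_hom_axioms_def group_BijGroup G.is_group)
qed

section \<open>The topology of the sheaf space and the local homeomorphism\<close>

lemma open_germs: "U \<in> \<B> \<Longrightarrow> s \<in> F U \<Longrightarrow> openin E (gm U s ` U)"
  unfolding sheaf_topology_def by (rule topology_generated_by_Basis) blast

text \<open>This is continuity of \<open>x \<mapsto> gm U s x\<close> in neighbourhood form. Since
  the topology is only given by generators, the proof is by induction on the generation of the open
  set.\<close>

lemma germ_neighbourhood:
  assumes "openin E O'" and "U \<in> \<B>" "s \<in> F U" "x \<in> U" "gm U s x \<in> O'"
  shows "\<exists>W\<in>\<B>. x \<in> W \<and> W \<subseteq> U \<and> gm U s ` W \<subseteq> O'"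
proof -
  have "generate_topology_on {gm U s ` U | U s. U \<in> \<B> \<and> s \<in> F U} O'"
    using assms(1) unfolding sheaf_topology_def by (rule openin_topology_generated_by)
  then show ?thesis
    using assms(5)
  proof induction
    case Empty
    then show ?case by simp
  next
    case (Int a b)
    then obtain W W' where W: "W \<in> \<B>" "x \<in> W" "W \<subseteq> U" "gm U s ` W \<subseteq> a"
      and W': "W' \<in> \<B>" "x \<in> W'" "gm U s ` W' \<subseteq> b"
      by blast
    then obtain Y where "Y \<in> \<B>" "x \<in> Y" "Y \<subseteq> W \<inter> W'"
      using basis_refine[of "W \<inter> W'" x] basis_open by blast
    moreover from this W W' have "Y \<subseteq> U" "gm U s ` Y \<subseteq> a \<inter> b"
      by blast+
    ultimately show ?case
      by blast
  next
    case (UN K)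
    then show ?case
      by (meson UnionE UnionI subset_iff)
  next
    case (Basis a)
    then obtain V t where V: "V \<in> \<B>" "t \<in> F V" "a = gm V t ` V" "gm U s x \<in> gm V t ` V"
      by blast
    then obtain y where y: "y \<in> V" "gm U s x = gm V t y"
      by blast
    then obtain W where W: "W \<in> \<B>" "x \<in> W" "W \<subseteq> U" "W \<subseteq> V" "r \<one> W U s = r \<one> W V t"
      using V assms(2-4) by (auto simp: germ_eq_iff)
    \<comment> \<open>Equality of germs at \<open>x\<close> spreads to all of \<open>W\<close>,
      because both sections have the same restriction to \<open>W\<close>.\<close>
    have "gm U s y = gm V t y" if "y \<in> W" for y
      using germ_restrict[of U W y s] germ_restrict[of V W y t] W V assms(2,3) that by simp
    with W V show ?case
      by (intro bexI[of _ W]) auto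
  qed
qed

text \<open>Every germ over a point of \<open>O'\<close> is represented by a section over some
  \<open>V \<subseteq> O'\<close>, and the germs of that section form an open set over
  \<open>O'\<close>.\<close>

lemma continuous_fst: "continuous_map E X fst"
  unfolding continuous_map_def
proof (intro conjI allI impI)
  show "fst \<in> topspace E \<rightarrow> topspace X"
    by (auto simp: topspace_E_germs germ_def basis_subset)
  fix O' assume O': "openin X O'"
  show "openin E {e \<in> topspace E. fst e \<in> O'}"
  proof (subst openin_subopen, intro ballI)
    fix e assume "e \<in> {e \<in> topspace E. fst e \<in> O'}"
    then obtain U s x where U: "U \<in> \<B>" "s \<in> F U" "x \<in> U" "e = gm U s x" "x \<in> O'"
      using topspace_E_germs by auto
    obtain V where V: "V \<in> \<B>" "x \<in> V" "V \<subseteq> U \<inter> O'"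
      using basis_refine[of "U \<inter> O'" x] U O' basis_open by blast
    have t: "r \<one> V U s \<in> F V"
      using restrict_closed V U one_image_basis by simp
    have "e = gm V (r \<one> V U s) x"
      using germ_restrict U V by simp
    moreover have "gm V (r \<one> V U s) ` V \<subseteq> {e \<in> topspace E. fst e \<in> O'}"
      using V t germ_in_E by auto
    ultimately show "\<exists>W. openin E W \<and> e \<in> W \<and> W \<subseteq> {e \<in> topspace E. fst e \<in> O'}"
      using open_germs[OF V(1) t] V by blast
  qed
qed

lemma continuous_germ:
  assumes U: "U \<in> \<B>" "s \<in> F U"
  shows "continuous_map (subtopology X U) E (gm U s)"
  unfolding continuous_map_def
proof (intro conjI allI impI)
  show "gm U s \<in> topspace (subtopology X U) \<rightarrow> topspace E"
    using germ_in_E U by auto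
  fix O' assume O': "openin E O'"
  have "openin X {x \<in> U. gm U s x \<in> O'}"
  proof (subst openin_subopen, intro ballI)
    fix x assume "x \<in> {x \<in> U. gm U s x \<in> O'}"
    then obtain W where "W \<in> \<B>" "x \<in> W" "W \<subseteq> U" "gm U s ` W \<subseteq> O'"
      using germ_neighbourhood[OF O' U] by blast
    then show "\<exists>W. openin X W \<and> x \<in> W \<and> W \<subseteq> {x \<in> U. gm U s x \<in> O'}"
      using basis_open by blast
  qed
  moreover have "{x \<in> topspace (subtopology X U). gm U s x \<in> O'} = {x \<in> U. gm U s x \<in> O'}"
    using basis_subset[OF U(1)] by auto
  ultimately show "openin (subtopology X U) {x \<in> topspace (subtopology X U). gm U s x \<in> O'}"
    by (auto simp: openin_open_subtopology basis_open[OF U(1)])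
qed

lemma local_homeomorphism_fst: "local_homeomorphism E X fst"
  unfolding local_homeomorphism_def
proof
  fix e assume "e \<in> topspace E"
  then obtain U s x where U: "U \<in> \<B>" "s \<in> F U" and x: "x \<in> U" "e = gm U s x"
    using topspace_E_germs by blast
  have im: "fst ` gm U s ` U = U"
    by (simp add: image_image)
  have "homeomorphic_maps (subtopology E (gm U s ` U)) (subtopology X U) fst (gm U s)"
    unfolding homeomorphic_maps_def
    using continuous_fst continuous_germ[OF U]
    by (auto simp: continuous_map_in_subtopology continuous_map_from_subtopology)
  then have "homeomorphic_map (subtopology E (gm U s ` U)) (subtopology X U) fst"
    using homeomorphic_map_maps by blast
  then show "\<exists>W. openin E W \<and> e \<in> W \<and> openin X (fst ` W) \<and>
        homeomorphic_map (subtopology E W) (subtopology X (fst ` W)) fst"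
    using open_germs[OF U] basis_open[OF U(1)] x by (intro exI[of _ "gm U s ` U"]) (simp add: im)
qed

section \<open>Joint continuity of the action\<close>

text \<open>Continuity of the action on the discrete set \<open>F V\<close> makes this set, the
  preimage of \<open>{t}\<close> under the orbit map of \<open>t\<close>, open in the stabilizer of
  \<open>V\<close>, which is itself open in the group.\<close>

lemma open_section_stabilizer:
  assumes V: "V \<in> \<B>" and t: "t \<in> F V"
  shows "openin T {k \<in> set_stab G \<phi> V. r (inv k) V V t = t}"
proof -
  have stab: "openin T (set_stab G \<phi> V)"
    using openin_set_stab[OF topological_group G_space compact] basis_open basis_closed V by blast
  have "continuous_map (subtopology T (set_stab G \<phi> V))
      (prod_topology (subtopology T (set_stab G \<phi> V)) (discrete_topology (F V))) (\<lambda>k. (k, t))"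
    using t by (auto simp: continuous_map_pairwise o_def)
  moreover have "continuous_map (prod_topology (subtopology T (set_stab G \<phi> V)) (discrete_topology (F V)))
      (discrete_topology (F V)) (\<lambda>(g, s). r (inv g) V V s)"
    using presheaf V by (simp add: G_presheaf_def)
  ultimately have "continuous_map (subtopology T (set_stab G \<phi> V)) (discrete_topology (F V))
      (\<lambda>k. r (inv k) V V t)"
    using continuous_map_compose by (fastforce simp: o_def)
  then have "openin (subtopology T (set_stab G \<phi> V))
      {k \<in> topspace (subtopology T (set_stab G \<phi> V)). r (inv k) V V t \<in> {t}}"
    by (rule openin_continuous_map_preimage) (use t in simp)
  moreover have "{k \<in> topspace (subtopology T (set_stab G \<phi> V)). r (inv k) V V t \<in> {t}}
      = {k \<in> set_stab G \<phi> V. r (inv k) V V t = t}"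
    by (auto simp: topspace_T set_stab_def)
  ultimately show ?thesis
    using stab by (simp add: openin_open_subtopology)
qed

lemma canonical_action_locally_constant:
  assumes g: "g \<in> carrier G" and U: "U \<in> \<B>" "s \<in> F U"
    and V: "V \<in> \<B>" "V \<subseteq> \<phi> g ` U" and t: "t = r (inv g) V U s"
    and k: "k \<in> set_stab G \<phi> V" "r (inv k) V V t = t"
    and y: "y \<in> U" "\<phi> g y \<in> V"
  shows "\<psi> (k \<otimes> g) (gm U s y) \<in> gm V t ` V"
proof -
  have kG: "k \<in> carrier G" and kV: "\<phi> k ` V = V"
    using k(1) by (auto simp: set_stab_def)
  have tF: "t \<in> F V"
    using pullback_closed g U V t by simp
  have kgy: "\<phi> k (\<phi> g y) \<in> V"
    using kV y(2) by blast
  have z: "gm V t (\<phi> g y) = \<psi> g (gm U s y)"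
    using canonical_action_germ[OF g U y(1) V(1) y(2) V(2)] t by simp
  have "\<psi> (k \<otimes> g) (gm U s y) = \<psi> k (gm V t (\<phi> g y))"
    using canonical_action_mult[OF kG g germ_in_E[OF U y(1)]] z by simp
  also have "\<dots> = gm V t (\<phi> k (\<phi> g y))"
    using canonical_action_germ[OF kG V(1) tF y(2) V(1) kgy] k(2) kV by simp
  finally show ?thesis
    using kgy by blast
qed

lemma continuous_canonical_action: "continuous_map (prod_topology T E) E (\<lambda>(g, e). \<psi> g e)"
  unfolding continuous_map_def
proof (intro conjI allI impI)
  show "(\<lambda>(g, e). \<psi> g e) \<in> topspace (prod_topology T E) \<rightarrow> topspace E"
    using canonical_action_closed(1) by (auto simp: topspace_T)
  fix O' assume O': "openin E O'"
  have mult_cont: "continuous_map (prod_topology T T) T (\<lambda>(g, h). g \<otimes> h)"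
    using topological_group by (simp add: topological_group_def)
  have right_cont: "continuous_map T T (\<lambda>h. h \<otimes> c)" if "c \<in> carrier G" for c
  proof -
    have "continuous_map T (prod_topology T T) (\<lambda>h. (h, c))"
      using that by (auto simp: continuous_map_pairwise o_def topspace_T)
    from continuous_map_compose[OF this mult_cont] show ?thesis
      by (simp add: o_def)
  qed
  let ?P = "{z \<in> topspace (prod_topology T E). (case z of (g, e) \<Rightarrow> \<psi> g e) \<in> O'}"
  show "openin (prod_topology T E) ?P"
    unfolding openin_prod_topology_alt
  proof (intro allI impI)
    fix g e assume "(g, e) \<in> ?P"
    then have g: "g \<in> carrier G" and e: "e \<in> topspace E" and gO: "\<psi> g e \<in> O'"
      by (auto simp: topspace_T)
    obtain U s x where U: "U \<in> \<B>" "s \<in> F U" and x: "x \<in> U" "e = gm U s x"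
      using e topspace_E_germs by blast
    obtain V0 where V0: "V0 \<in> \<B>" "\<phi> g x \<in> V0" "V0 \<subseteq> \<phi> g ` U"
      using basis_act_neighbourhood g U x by blast
    define t0 where "t0 = r (inv g) V0 U s"
    have t0: "t0 \<in> F V0"
      using pullback_closed g U V0 t0_def by simp
    have "gm V0 t0 (\<phi> g x) \<in> O'"
      using canonical_action_germ[OF g U x(1) V0] gO x t0_def by simp
    \<comment> \<open>\<open>V0\<close> serves only to express the image germ by a section;
      shrinking it to \<open>V\<close> puts the whole sheet of that section inside
      \<open>O'\<close>.\<close>
    then obtain V where V: "V \<in> \<B>" "\<phi> g x \<in> V" "V \<subseteq> V0" "gm V0 t0 ` V \<subseteq> O'"
      using germ_neighbourhood[OF O' V0(1) t0 V0(2)] by blast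
    define t where "t = r (inv g) V U s"
    have VU: "V \<subseteq> \<phi> g ` U"
      using V V0 by blast
    have tF: "t \<in> F V"
      using pullback_closed g U V VU t_def by simp
    have "r \<one> V V0 t0 = t"
      unfolding t_def t0_def
      using restrict_one_left[OF V(1) V0(1) U(1) _ V(3) inv_image_subset[OF g U(1) V0(3)] U(2)] g
      by simp
    then have tO': "gm V t ` V \<subseteq> O'"
      using germ_restrict[OF V0(1) V(1) _ V(3) t0] V(4) by auto
    define K where "K = {k \<in> set_stab G \<phi> V. r (inv k) V V t = t}"
    have K: "openin T K"
      unfolding K_def using open_section_stabilizer V tF by blast
    \<comment> \<open>This is the coset \<open>K g\<close>, written as a preimage under right
      translation by \<open>inv g\<close> so that its openness follows from continuity.\<close>
    define N where "N = {h \<in> topspace T. h \<otimes> inv g \<in> K}"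
    have N: "openin T N"
      unfolding N_def by (rule openin_continuous_map_preimage[OF right_cont K]) (use g in simp)
    have gN: "g \<in> N"
    proof -
      have "\<one> \<in> K"
        unfolding K_def set_stab_def using one_image_basis V tF by (simp add: restrict_id)
      then show ?thesis
        unfolding N_def using g by (simp add: topspace_T)
    qed
    \<comment> \<open>The part of the sheet of \<open>s\<close> lying over the points that
      \<open>g\<close> itself moves into \<open>V\<close>; elements of \<open>K\<close> then keep
      the moved points in \<open>V\<close>.\<close>
    define Q where "Q = gm U s ` U \<inter> {e \<in> topspace E. fst e \<in> {y \<in> topspace X. \<phi> g y \<in> V}}"
    have Q: "openin E Q"
      unfolding Q_def
      by (intro openin_Int open_germs U openin_continuous_map_preimage[OF continuous_fst]
          openin_continuous_map_preimage[OF act_continuous[OF g]] basis_open V)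
    have eQ: "e \<in> Q"
      unfolding Q_def using x e V basis_subset[OF U(1)] by auto
    have "N \<times> Q \<subseteq> ?P"
    proof
      fix z assume "z \<in> N \<times> Q"
      then obtain h q where z: "z = (h, q)" and h: "h \<in> N" and q: "q \<in> Q"
        by blast
      have hG: "h \<in> carrier G"
        using h by (simp add: N_def topspace_T)
      then have "h = (h \<otimes> inv g) \<otimes> g"
        using g by (simp add: G.m_assoc)
      moreover have "h \<otimes> inv g \<in> set_stab G \<phi> V" "r (inv (h \<otimes> inv g)) V V t = t"
        using h by (auto simp: N_def K_def)
      moreover obtain y where "y \<in> U" "\<phi> g y \<in> V" "q = gm U s y"
        using q by (auto simp: Q_def)
      ultimately have "\<psi> h q \<in> gm V t ` V"
        using canonical_action_locally_constant[OF g U V(1) VU t_def] by metis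
      moreover have "q \<in> topspace E"
        using q by (simp add: Q_def)
      ultimately show "z \<in> ?P"
        using tO' hG by (auto simp: z topspace_T)
    qed
    with N gN Q eQ show "\<exists>N Q. openin T N \<and> openin E Q \<and> g \<in> N \<and> e \<in> Q \<and> N \<times> Q \<subseteq> ?P"
      by blast
  qed
qed

lemma G_sheaf_canonical: "G_sheaf G T X \<phi> E \<psi> fst"
  unfolding G_sheaf_def G_space_def
  using group_action_canonical continuous_canonical_action local_homeomorphism_fst
    canonical_action_closed(2) by blast

end

text \<open>The first conjunct certifies that the action is the canonical one: since its definition
  uses a choice operator, existence of an admissible \<open>V\<close> and independence of it have to
  be asserted separately.\<close>

theorem theorem4p3:
  fixes G :: "('g, 'm) monoid_scheme" and T :: "'g topology"
    and X :: "'x topology" and \<phi> :: "'g \<Rightarrow> 'x \<Rightarrow> 'x" and \<B> :: "'x set set"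
    and F :: "'x set \<Rightarrow> 's set" and r :: "'g \<Rightarrow> 'x set \<Rightarrow> 'x set \<Rightarrow> 's \<Rightarrow> 's"
  assumes "profinite_group G T"
    and "profinite_space X" and "G_space G T X \<phi>"
    and "open_closed_basis X \<B>"
    and "G_presheaf G T \<phi> \<B> F r"
  shows "(\<forall>g\<in>carrier G. \<forall>U\<in>\<B>. \<forall>s\<in>F U. \<forall>x\<in>U.
            (\<exists>V\<in>\<B>. \<phi> g x \<in> V \<and> V \<subseteq> \<phi> g ` U) \<and>
            (\<forall>V\<in>\<B>. \<phi> g x \<in> V \<and> V \<subseteq> \<phi> g ` U \<longrightarrow>
               canonical_action G X \<phi> \<B> F r g (germ G \<B> F r U s x)
                 = germ G \<B> F r V (r (inv\<^bsub>G\<^esub> g) V U s) (\<phi> g x)))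
       \<and> G_sheaf G T X \<phi> (sheaf_topology G \<B> F r) (canonical_action G X \<phi> \<B> F r) fst"
proof -
  interpret equivariant_presheaf G T X \<phi> \<B> F r
    using assms by (simp add: equivariant_presheaf_def profinite_group_def profinite_space_def)
  show ?thesis
    by (intro conjI ballI impI basis_act_neighbourhood canonical_action_germ G_sheaf_canonical) auto
qed

end
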